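(* Let $\alpha=[a_0;a_1,a_2,\dots]$ be an (infinite) simple continued fraction with $a_0$ odd and all other $a_i$ ($i\ge 1$) even. If a natural number $N$ has base-$\alpha$ continued fraction expansion $(Z_I, Z_{I-1}, \ldots, Z_1, Z_0)$, then $$S_N(\alpha) =-\sum_{i=0}^I \bigg( \prod_{t=i+1}^I (-1)^{Z_t} \bigg) [\![ i\text{ even} ]\!]\, [\![ Z_i \text{ odd} ]\!].$$
   Context: For a real number $\alpha$ and an integer $N\ge 0$, $S_N(\alpha) := \sum_{n=1}^N (-1)^{\lfloor n\alpha\rfloor}$. Natural numbers start at $1$. For a statement $Q$, $[\![ Q ]\!]$ equals $1$ if $Q$ is true and $0$ if $Q$ is false. Empty products equal $1$. In a simple continued fraction all $a_i$ are integers and $a_i$ is positive for $i>0$; $[a_0;a_1,a_2,\dots]=\lim_{r\to\infty}[a_0;a_1,\dots,a_r]$, where $[a_0]=a_0$ and $[a_0;a_1,\dots,a_r]=a_0+1/[a_1;a_2,\dots,a_r]$. This limit always exists and is irrational. The continuants $q_i$ of $\alpha$ are defined by $q_{-2}=1$, $q_{-1}=0$, $q_i=a_iq_{i-1}+q_{i-2}$ for $i\ge0$. The base-$\alpha$ continued fraction expansion (CFE) of a nonnegative integer $N$ is the sequence $(Z_i)_{i\ge0}$ of nonnegative integers obtained by writing $N$ as a sum of the continuants $q_0,q_1,q_2,\dots$ greedily (always using the largest possible one) and letting $Z_i$ be the number of times $q_i$ is used. Equivalently, it is the sequence of nonnegative integers with $N=\sum_{i=0}^\infty Z_iq_i$ and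 $\sum_{i=0}^j Z_iq_i<q_{j+1}$ for every $j\ge 0$. One writes $N=(Z_I,Z_{I-1},\dots,Z_1,Z_0)$ when $Z_i=0$ for all $i>I$. *)

theory Defs
  imports Complex_Main
begin

fun fin_cfrac :: "(nat \<Rightarrow> int) \<Rightarrow> nat \<Rightarrow> real" where
  "fin_cfrac a 0 = of_int (a 0)"
| "fin_cfrac a (Suc r) = of_int (a 0) + 1 / fin_cfrac (\<lambda>i. a (Suc i)) r"

definition is_simple_cfrac :: "(nat \<Rightarrow> int) \<Rightarrow> real \<Rightarrow> bool" where
  "is_simple_cfrac a \<alpha> \<longleftrightarrow> (\<forall>i>0. a i > 0) \<and> fin_cfrac a \<longlonglongrightarrow> \<alpha>"

text \<open>The recursion for the continuants starts at index \<open>-2\<close>, so it is defined with its index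
  shifted by 2.\<close>

fun shifted_continuant :: "(nat \<Rightarrow> int) \<Rightarrow> nat \<Rightarrow> int" where
  "shifted_continuant a 0 = 1"
| "shifted_continuant a (Suc 0) = 0"
| "shifted_continuant a (Suc (Suc i)) =
     a i * shifted_continuant a (Suc i) + shifted_continuant a i"

definition continuant :: "(nat \<Rightarrow> int) \<Rightarrow> nat \<Rightarrow> int" where
  "continuant a i = shifted_continuant a (i + 2)"

text \<open>The greedy expansion of \<open>N\<close>: each step takes off the largest continuant that is at most the
  current number. Largest is meant in terms of the index, which matters only if \<open>a 1 = 1\<close>,
  where \<open>q\<^sub>0 = q\<^sub>1 = 1\<close>; then \<open>q\<^sub>1\<close> is the one used.\<close>

inductive is_cfe :: "(nat \<Rightarrow> int) \<Rightarrow> nat \<Rightarrow> (nat \<Rightarrow> nat) \<Rightarrow> bool" for a where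
  zero: "is_cfe a 0 (\<lambda>_. 0)"
| step: "\<lbrakk>continuant a i \<le> int N; \<forall>j>i. int N < continuant a j;
          is_cfe a M Z; int M = int N - continuant a i\<rbrakk>
         \<Longrightarrow> is_cfe a N (Z(i := Z i + 1))"

definition sign_sum :: "nat \<Rightarrow> real \<Rightarrow> real" where
  "sign_sum N \<alpha> = (\<Sum>n=1..N. (-1) powi \<lfloor>real n * \<alpha>\<rfloor>)"

lemma continuant_0: "continuant a 0 = 1"
  by (simp add: continuant_def numeral_2_eq_2)

lemma continuant_1: "continuant a (Suc 0) = a 1"
  by (simp add: continuant_def numeral_2_eq_2)

lemma continuant_rec:
  "continuant a (Suc (Suc i)) = a (Suc (Suc i)) * continuant a (Suc i) + continuant a i"
  by (simp add: continuant_def numeral_2_eq_2)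

lemma continuant_pos_mono:
  assumes "\<forall>i>0. a i > 0"
  shows "continuant a i > 0 \<and> continuant a i \<le> continuant a (Suc i)"
proof (induction i)
  case 0
  have "a 1 > 0" using assms by auto
  then show ?case by (simp add: continuant_0 continuant_1)
next
  case (Suc i)
  have "a (Suc (Suc i)) \<ge> 1" using assms by (metis int_one_le_iff_zero_less zero_less_Suc)
  then have "1 * continuant a (Suc i) \<le> a (Suc (Suc i)) * continuant a (Suc i)"
    using Suc by (intro mult_right_mono) auto
  then show ?case using Suc unfolding continuant_rec by linarith
qed

lemma continuant_pos: "\<forall>i>0. a i > 0 \<Longrightarrow> continuant a i > 0"
  using continuant_pos_mono by blast

lemma continuant_mono: "\<forall>i>0. a i > 0 \<Longrightarrow> i \<le> j \<Longrightarrow> continuant a i \<le> continuant a j"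
  by (rule lift_Suc_mono_le) (use continuant_pos_mono in blast)+

lemma sum_extend:
  fixes q :: "nat \<Rightarrow> int"
  assumes "\<forall>i>I. Z i = 0" "I \<le> J"
  shows "(\<Sum>i\<le>J. int (Z i) * q i) = (\<Sum>i\<le>I. int (Z i) * q i)"
  by (rule sum.mono_neutral_right) (use assms in auto)

lemma sum_upd:
  fixes q :: "nat \<Rightarrow> int"
  shows "(\<Sum>k\<le>j. int ((Z(i := Z i + 1)) k) * q k) =
         (\<Sum>k\<le>j. int (Z k) * q k) + (if i \<le> j then q i else 0)"
proof -
  have "(\<Sum>k\<le>j. int ((Z(i := Z i + 1)) k) * q k) =
        (\<Sum>k\<le>j. int (Z k) * q k + (if k = i then q i else 0))"
    by (rule sum.cong) (auto simp: algebra_simps)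
  then show ?thesis by (simp add: sum.distrib)
qed

text \<open>The greedy expansion is the one characterised by bounded partial sums.\<close>

lemma is_cfe_imp_partial_sums:
  assumes pos: "\<forall>i>0. a i > 0" and "is_cfe a N Z"
  shows "(\<exists>I. (\<forall>i>I. Z i = 0) \<and> int N = (\<Sum>i\<le>I. int (Z i) * continuant a i)) \<and>
         (\<forall>j. (\<Sum>i\<le>j. int (Z i) * continuant a i) < continuant a (Suc j))"
  using assms(2)
proof (induction rule: is_cfe.induct)
  case zero
  show ?case using continuant_pos[OF pos] by simp
next
  case (step i N M Z)
  let ?q = "continuant a" and ?Z = "Z(i := Z i + 1)"
  obtain I where I: "\<forall>i>I. Z i = 0" "int M = (\<Sum>i\<le>I. int (Z i) * ?q i)"
    using step.IH by blast
  have Zi: "Z k = 0" if "k > i" for k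
  proof (rule ccontr)
    assume nz: "Z k \<noteq> 0"
    then have "k \<le> I" using I(1) by (meson not_le)
    have "?q k \<le> int (Z k) * ?q k"
      using nz continuant_pos[OF pos, of k] by simp
    also have "\<dots> \<le> (\<Sum>i\<le>I. int (Z i) * ?q i)"
      by (rule member_le_sum) (use \<open>k \<le> I\<close> continuant_pos[OF pos] in \<open>auto simp: less_imp_le\<close>)
    also have "\<dots> = int N - ?q i" using I step.hyps by simp
    finally show False using step.hyps(2) that continuant_pos[OF pos, of i] by force
  qed
  have M: "(\<Sum>k\<le>j. int (Z k) * ?q k) = int M" if "j \<ge> i" for j
    using sum_extend[of i Z "max j I" ?q] sum_extend[of I Z "max j I" ?q]
      sum_extend[of i Z j ?q] Zi I that by simp
  have N: "(\<Sum>k\<le>j. int (?Z k) * ?q k) = int N" if "j \<ge> i" for j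
    unfolding sum_upd using M that step.hyps by simp
  have "(\<Sum>k\<le>j. int (?Z k) * ?q k) < ?q (Suc j)" for j
  proof (cases "i \<le> j")
    case True
    then show ?thesis using N[of j] step.hyps(2) by simp
  next
    case False
    then show ?thesis unfolding sum_upd using step.IH by simp
  qed
  moreover have "\<forall>k>i. ?Z k = 0" using Zi by simp
  ultimately show ?case using N[of i] by (metis order_refl)
qed

lemma partial_sums_imp_is_cfe:
  assumes pos: "\<forall>i>0. a i > 0"
    and "\<exists>I. (\<forall>i>I. Z i = 0) \<and> int N = (\<Sum>i\<le>I. int (Z i) * continuant a i)"
    and "\<forall>j. (\<Sum>i\<le>j. int (Z i) * continuant a i) < continuant a (Suc j)"
  shows "is_cfe a N Z"
  using assms(2,3)
proof (induction N arbitrary: Z rule: less_induct)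
  case (less N)
  let ?q = "continuant a"
  have qpos: "?q i > 0" for i using continuant_pos[OF pos] .
  obtain I where I: "\<forall>i>I. Z i = 0" "int N = (\<Sum>i\<le>I. int (Z i) * ?q i)"
    using less.prems by blast
  show ?case
  proof (cases "\<forall>i. Z i = 0")
    case True
    then have "Z = (\<lambda>_. 0)" "N = 0" using I by auto
    then show ?thesis using is_cfe.zero by simp
  next
    case False
    define i where "i = (GREATEST i. Z i \<noteq> 0)"
    have b: "\<forall>k. Z k \<noteq> 0 \<longrightarrow> k \<le> I" using I(1) by (meson not_le)
    have i: "Z i \<noteq> 0"
      unfolding i_def using False b by (metis (mono_tags, lifting) GreatestI_nat)
    have above: "\<forall>k>i. Z k = 0"
      unfolding i_def using b by (metis (mono_tags, lifting) Greatest_le_nat not_le)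
    define Y where "Y = Z(i := Z i - 1)"
    have Z: "Z = Y(i := Y i + 1)" using i by (auto simp: Y_def)
    have su: "(\<Sum>k\<le>j. int (Z k) * ?q k) =
              (\<Sum>k\<le>j. int (Y k) * ?q k) + (if i \<le> j then ?q i else 0)" for j
      by (subst (1) Z) (rule sum_upd)
    have N: "int N = (\<Sum>k\<le>i. int (Z k) * ?q k)"
      using sum_extend[of i Z I ?q] above I i b by simp
    have Ynn: "(\<Sum>k\<le>i. int (Y k) * ?q k) \<ge> 0"
      by (rule sum_nonneg) (use qpos in \<open>auto simp: less_imp_le\<close>)
    have le: "?q i \<le> int N" using N su[of i] Ynn by simp
    have lt: "\<forall>j>i. int N < ?q j"
      using less.prems(2) N continuant_mono[OF pos] by (metis Suc_leI less_le_trans)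
    define M where "M = nat (int N - ?q i)"
    have M: "int M = int N - ?q i" using le by (simp add: M_def)
    have "is_cfe a M Y"
    proof (rule less.IH)
      show "M < N" using M qpos[of i] by linarith
      show "\<exists>I. (\<forall>i>I. Y i = 0) \<and> int M = (\<Sum>i\<le>I. int (Y i) * ?q i)"
        by (rule exI[of _ i]) (use M N su[of i] above in \<open>auto simp: Y_def\<close>)
      show "\<forall>j. (\<Sum>k\<le>j. int (Y k) * ?q k) < ?q (Suc j)"
      proof
        fix j
        have "(\<Sum>k\<le>j. int (Y k) * ?q k) \<le> (\<Sum>k\<le>j. int (Z k) * ?q k)"
          using su[of j] qpos[of i] by (simp split: if_splits)
        then show "(\<Sum>k\<le>j. int (Y k) * ?q k) < ?q (Suc j)"
          using less.prems(2) by (meson le_less_trans)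
      qed
    qed
    from is_cfe.step[OF le lt this M] show ?thesis by (subst Z)
  qed
qed

lemma is_cfe_iff:
  assumes "\<forall>i>0. a i > 0"
  shows "is_cfe a N Z \<longleftrightarrow>
    (\<exists>I. (\<forall>i>I. Z i = 0) \<and> int N = (\<Sum>i\<le>I. int (Z i) * continuant a i)) \<and>
    (\<forall>j. (\<Sum>i\<le>j. int (Z i) * continuant a i) < continuant a (Suc j))"
  using is_cfe_imp_partial_sums[OF assms] partial_sums_imp_is_cfe[OF assms] by blast

end

theory Submission
  imports Defs
begin

text \<open>
  Write \<open>p\<^sub>i / q\<^sub>i\<close> for the convergents and \<open>D\<^sub>i = q\<^sub>i \<alpha> - p\<^sub>i\<close>. The numbers \<open>D\<^sub>i\<close> alternate in sign, and
  since \<open>(p\<^sub>i, q\<^sub>i)\<close> and \<open>(p\<^sub>i\<^sub>+\<^sub>1, q\<^sub>i\<^sub>+\<^sub>1)\<close> form a basis of the integer lattice, no integer lies between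
  \<open>m \<alpha>\<close> and \<open>m \<alpha> + D\<^sub>i\<close> when \<open>0 < m < q\<^sub>i\<^sub>+\<^sub>1\<close> (\<open>lattice_gap\<close>, \<open>floor_add_error\<close>). Hence
  \<open>\<lfloor>(m + q\<^sub>i) \<alpha>\<rfloor> = p\<^sub>i + \<lfloor>m \<alpha>\<rfloor>\<close>. When \<open>a\<^sub>0\<close> is odd and the other \<open>a\<^sub>i\<close> are even, every \<open>p\<^sub>i\<close> is odd, so
  translation by \<open>q\<^sub>i\<close> flips the sign of the summand, which gives
  \<open>S(q\<^sub>i + M) = S(q\<^sub>i) - S(M)\<close> for \<open>M < q\<^sub>i\<^sub>+\<^sub>1\<close> (\<open>sign_sum_add_continuant\<close>).

  Two consecutive blocks of length \<open>q\<^sub>i\<close> therefore cancel. As \<open>q\<^sub>i\<^sub>+\<^sub>1 = a\<^sub>i\<^sub>+\<^sub>1 q\<^sub>i + q\<^sub>i\<^sub>-\<^sub>1\<close> with \<open>a\<^sub>i\<^sub>+\<^sub>1\<close> even,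
  this gives \<open>S(q\<^sub>i\<^sub>+\<^sub>1) = S(q\<^sub>i\<^sub>-\<^sub>1)\<close>, and so \<open>S(q\<^sub>i)\<close> is \<open>-1\<close> for even \<open>i\<close> and \<open>0\<close> for odd \<open>i\<close>
  (\<open>sign_sum_continuant\<close>).
  Removing one greedy summand \<open>q\<^sub>i\<close> at a time from \<open>N\<close> then evaluates \<open>S(N)\<close>, and the right-hand side
  of the theorem obeys the same recursion (\<open>digit_sum_increment\<close>).
\<close>

section \<open>Convergents and their errors\<close>

text \<open>The numerators of the convergents, with the same index shift as the continuants, so that
  the convergent with index \<open>i\<close> is at \<open>i + 2\<close>.\<close>

fun shifted_numerator :: "(nat \<Rightarrow> int) \<Rightarrow> nat \<Rightarrow> int" where
  "shifted_numerator a 0 = 0"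
| "shifted_numerator a (Suc 0) = 1"
| "shifted_numerator a (Suc (Suc i)) =
     a i * shifted_numerator a (Suc i) + shifted_numerator a i"

definition convergent_error :: "(nat \<Rightarrow> int) \<Rightarrow> real \<Rightarrow> nat \<Rightarrow> real" where
  "convergent_error a \<alpha> k =
     real_of_int (shifted_continuant a k) * \<alpha> - real_of_int (shifted_numerator a k)"

lemma numerator_continuant_det:
  "shifted_numerator a (Suc k) * shifted_continuant a k
     - shifted_numerator a k * shifted_continuant a (Suc k) = (-1) ^ k"
proof (induction k)
  case (Suc k)
  have "(a k * p' + p) * q' - p' * (a k * q' + q) = - (p' * q - p * q')" for p q p' q' :: int
    by algebra
  then show ?case using Suc.IH by (simp only: shifted_numerator.simps shifted_continuant.simps) simp
qed simp

lemma shifted_continuant_pos: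
  assumes "\<forall>i>0. a i > 0" and "k \<ge> 2"
  shows "shifted_continuant a k > 0"
proof -
  have "k - 2 + 2 = k" using assms(2) by simp
  then show ?thesis using continuant_pos[OF assms(1), of "k - 2"] by (simp only: continuant_def)
qed

lemma shifted_continuant_nonneg:
  assumes "\<forall>i>0. a i > 0"
  shows "shifted_continuant a k \<ge> 0"
proof -
  consider "k = 0" | "k = 1" | "k \<ge> 2" by linarith
  then show ?thesis
    using shifted_continuant_pos[OF assms, of k] by cases auto
qed

lemma fin_cfrac_ge_1:
  assumes "\<And>i. a i \<ge> 1"
  shows "fin_cfrac a r \<ge> 1"
  using assms
proof (induction r arbitrary: a)
  case (Suc r)
  have "fin_cfrac (\<lambda>i. a (Suc i)) r \<ge> 1" by (rule Suc.IH) (rule Suc.prems)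
  then have "1 / fin_cfrac (\<lambda>i. a (Suc i)) r \<ge> 0" by simp
  moreover have "real_of_int (a 0) \<ge> 1" using Suc.prems[of 0] by simp
  ultimately have "a 0 + 1 / fin_cfrac (\<lambda>i. a (Suc i)) r \<ge> 1" by linarith
  then show ?case by simp
qed simp

lemma fin_cfrac_le:
  assumes "\<And>i. a i \<ge> 1"
  shows "fin_cfrac a r \<le> real_of_int (a 0) + 1"
proof (cases r)
  case (Suc s)
  have "fin_cfrac (\<lambda>i. a (Suc i)) s \<ge> 1" by (rule fin_cfrac_ge_1) (rule assms)
  then show ?thesis using Suc by simp
qed simp

text \<open>A continued fraction is the Moebius transform, with the convergents as coefficients, of any
  of its tails.\<close>

lemma fin_cfrac_split:
  assumes pos: "\<forall>i>0. a i > 0"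
  shows "fin_cfrac a (n + r) =
    (fin_cfrac (\<lambda>i. a (i + n)) r * shifted_numerator a (Suc n) + shifted_numerator a n) /
    (fin_cfrac (\<lambda>i. a (i + n)) r * shifted_continuant a (Suc n) + shifted_continuant a n)"
proof (induction n arbitrary: r)
  case (Suc n)
  define x where "x = fin_cfrac (\<lambda>i. a (i + Suc n)) r"
  have "a (i + Suc n) \<ge> 1" for i
    using pos by (metis add_Suc_right int_one_le_iff_zero_less zero_less_Suc)
  then have x: "x \<ge> 1" unfolding x_def by (rule fin_cfrac_ge_1)
  have tail: "fin_cfrac (\<lambda>i. a (i + n)) (Suc r) = a n + 1 / x" by (simp add: x_def)
  have cross: "(a n + 1 / x) * u + v = (x * (a n * u + v) + u) / x" for u v :: real
    using x by (simp add: field_simps)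
  show ?case
    using Suc.IH[of "Suc r"] x unfolding tail cross by (simp add: x_def)
qed simp

text \<open>For a finite continued fraction the error of the convergent is, by the determinant identity, a
  power of \<open>-1\<close> over a denominator that the first partial quotient of the tail bounds. The
  bound is uniform in the length, so the sign stays strict in the limit.\<close>

lemma convergent_error_sign:
  assumes "is_simple_cfrac a \<alpha>" and "k \<ge> 2"
  shows "(-1) ^ k * convergent_error a \<alpha> k > 0"
proof -
  have pos: "\<forall>i>0. a i > 0" and lim: "fin_cfrac a \<longlonglongrightarrow> \<alpha>"
    using assms(1) by (auto simp: is_simple_cfrac_def)
  define n where "n = k - 1"
  have k: "k = Suc n" and n: "n \<ge> 1" using assms(2) by (auto simp: n_def)
  define P Q where "P = (\<lambda>k. real_of_int (shifted_numerator a k))"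
    and "Q = (\<lambda>k. real_of_int (shifted_continuant a k))"
  have det: "P (Suc n) * Q n - P n * Q (Suc n) = (-1) ^ n"
    using arg_cong[OF numerator_continuant_det[of a n], of real_of_int] by (simp add: P_def Q_def)
  have Qk: "Q (Suc n) > 0" unfolding Q_def using shifted_continuant_pos[OF pos] assms(2) k by simp
  have Qn: "Q n \<ge> 0" unfolding Q_def using shifted_continuant_nonneg[OF pos] by simp
  have a1: "a (i + n) \<ge> 1" for i
    using pos n by (metis add_gr_0 int_one_le_iff_zero_less less_le_trans zero_less_one)
  define c where "c = 1 / ((a n + 1) * Q (Suc n) + Q n)"
  have an: "real_of_int (a n) \<ge> 1" using a1[of 0] by simp
  have cpos: "c > 0" unfolding c_def using an Qk Qn by (simp add: add_pos_nonneg)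
  have bound: "c \<le> (-1) ^ k * (Q k * fin_cfrac a (n + r) - P k)" for r
  proof -
    define x where "x = fin_cfrac (\<lambda>i. a (i + n)) r"
    have x: "x \<ge> 1" "x \<le> a n + 1"
      unfolding x_def using fin_cfrac_ge_1[of "\<lambda>i. a (i + n)" r] fin_cfrac_le[of "\<lambda>i. a (i + n)" r] a1
      by auto
    have d: "x * Q (Suc n) + Q n > 0" using x Qk Qn by (simp add: add_pos_nonneg)
    have "Q k * fin_cfrac a (n + r) - P k
        = Q (Suc n) * ((x * P (Suc n) + P n) / (x * Q (Suc n) + Q n)) - P (Suc n)"
      using fin_cfrac_split[OF pos, of n r] by (simp add: x_def P_def Q_def k)
    also have "\<dots> = - (P (Suc n) * Q n - P n * Q (Suc n)) / (x * Q (Suc n) + Q n)"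
      using d by (simp add: field_simps)
    also have "\<dots> = (-1) ^ k / (x * Q (Suc n) + Q n)" unfolding det k by simp
    finally have e: "(-1) ^ k * (Q k * fin_cfrac a (n + r) - P k) = 1 / (x * Q (Suc n) + Q n)"
      by (simp flip: power_mult_distrib)
    have "x * Q (Suc n) + Q n \<le> (a n + 1) * Q (Suc n) + Q n"
      using x Qk by (intro add_right_mono mult_right_mono) auto
    then show ?thesis unfolding e c_def using d by (intro divide_left_mono) auto
  qed
  have "(\<lambda>r. fin_cfrac a (n + r)) \<longlonglongrightarrow> \<alpha>"
    using LIMSEQ_ignore_initial_segment[OF lim, of n] by (simp add: add.commute)
  then have "(\<lambda>r. (-1) ^ k * (Q k * fin_cfrac a (n + r) - P k)) \<longlonglongrightarrow> (-1) ^ k * (Q k * \<alpha> - P k)"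
    by (intro tendsto_intros)
  then have "c \<le> (-1) ^ k * (Q k * \<alpha> - P k)"
    by (rule LIMSEQ_le_const) (use bound in blast)
  then show ?thesis using cpos by (simp add: convergent_error_def P_def Q_def)
qed

section \<open>Translation by a continuant\<close>

text \<open>In the basis \<open>(q, p)\<close>, \<open>(q', p')\<close> of the integer lattice the point \<open>(m, k)\<close> has coordinates
  \<open>(x, y)\<close>, and \<open>m \<alpha> - k = x D + y D'\<close>. The bounds on \<open>m\<close> force \<open>x \<ge> 1\<close> if \<open>y \<le> 0\<close> and \<open>x \<le> -1\<close> if
  \<open>y \<ge> 1\<close>, and because \<open>D\<close> and \<open>D'\<close> have opposite signs the two terms do not work against
  each other.\<close>

lemma lattice_gap:
  fixes p q p' q' m k :: int and \<alpha> :: real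
  defines "D \<equiv> q * \<alpha> - p" and "D' \<equiv> q' * \<alpha> - p'"
  assumes det: "\<bar>p' * q - p * q'\<bar> = 1" and opp: "D * D' < 0"
    and q: "0 < q" and m: "0 < m" "m < q'"
  shows "(m * \<alpha> - k) * D \<ge> D\<^sup>2 \<or> (m * \<alpha> - k) * D < - D\<^sup>2"
proof -
  define e where "e = p' * q - p * q'"
  have e: "e * e = 1" using det unfolding e_def by (metis abs_mult_self mult_1)
  define x y where "x = e * (m * p' - k * q')" and "y = e * (k * q - m * p)"
  have "x * q + y * q' = e * e * m" by (simp add: x_def y_def e_def algebra_simps)
  then have mxy: "m = x * q + y * q'" using e by simp
  have "x * p + y * p' = e * e * k" by (simp add: x_def y_def e_def algebra_simps)
  then have kxy: "k = x * p + y * p'" using e by simp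
  have "m * \<alpha> - k = x * D + y * D'" by (simp add: mxy kxy D_def D'_def algebra_simps)
  then have v: "(m * \<alpha> - k) * D = x * D\<^sup>2 + y * (D * D')"
    by (simp add: power2_eq_square algebra_simps)
  show ?thesis
  proof (cases "y \<le> 0")
    case True
    then have "y * q' \<le> 0" using m by (simp add: mult_nonpos_nonneg)
    then have "x * q > 0" using mxy m by linarith
    then have "x \<ge> 1" using q by (simp add: zero_less_mult_iff)
    then have "1 * D\<^sup>2 \<le> x * D\<^sup>2" by (intro mult_right_mono) auto
    moreover have "y * (D * D') \<ge> 0"
      using True opp mult_nonpos_nonpos[of "real_of_int y" "D * D'"] by simp
    ultimately show ?thesis using v by simp
  next
    case False
    then have "1 * q' \<le> y * q'" using m by (intro mult_right_mono) auto
    then have "x * q < 0" using mxy m by linarith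
    then have "x \<le> -1" using q by (simp add: mult_less_0_iff)
    then have "x * D\<^sup>2 \<le> (-1) * D\<^sup>2" by (intro mult_right_mono) (auto simp flip: of_int_minus)
    moreover have "y * (D * D') < 0" using False opp mult_pos_neg[of "real_of_int y" "D * D'"] by simp
    ultimately show ?thesis using v by simp
  qed
qed

lemma floor_add_error:
  fixes a :: "nat \<Rightarrow> int" and \<alpha> :: real and m :: int
  assumes cf: "is_simple_cfrac a \<alpha>" and k: "k \<ge> 2"
    and m: "0 < m" "m < shifted_continuant a (Suc k)"
  shows "\<lfloor>m * \<alpha> + convergent_error a \<alpha> k\<rfloor> = \<lfloor>m * \<alpha>\<rfloor>"
proof -
  define D D' where "D = convergent_error a \<alpha> k" and "D' = convergent_error a \<alpha> (Suc k)"
  have "((-1) ^ k * D) * ((-1) ^ Suc k * D') > 0"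
    unfolding D_def D'_def using cf k by (intro mult_pos_pos convergent_error_sign) auto
  moreover have "((-1) ^ k * D) * ((-1) ^ Suc k * D') = - (D * D')"
    by (cases "even k") auto
  ultimately have opp: "D * D' < 0" by linarith
  have pos: "\<forall>i>0. a i > 0" using cf by (simp add: is_simple_cfrac_def)
  have det: "\<bar>shifted_numerator a (Suc k) * shifted_continuant a k
     - shifted_numerator a k * shifted_continuant a (Suc k)\<bar> = 1"
    unfolding numerator_continuant_det by simp
  have gap: "(m * \<alpha> - j) * D \<ge> D\<^sup>2 \<or> (m * \<alpha> - j) * D < - D\<^sup>2" for j :: int
    using lattice_gap[OF det _ shifted_continuant_pos[OF pos k] m] opp
    unfolding D_def D'_def convergent_error_def by blast
  have "D \<noteq> 0" using opp by auto
  then consider "D > 0" | "D < 0" by linarith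
  then have "\<lfloor>m * \<alpha> + D\<rfloor> = \<lfloor>m * \<alpha>\<rfloor>"
  proof cases
    case 1
    define v where "v = m * \<alpha> - (\<lfloor>m * \<alpha>\<rfloor> + 1)"
    have "v < 0" unfolding v_def by linarith
    then have "v * D < 0" using 1 by (rule mult_neg_pos)
    moreover have "D\<^sup>2 \<ge> 0" by simp
    moreover have "v * D \<ge> D\<^sup>2 \<or> v * D < - D\<^sup>2"
      using gap[of "\<lfloor>m * \<alpha>\<rfloor> + 1"] by (simp add: v_def)
    ultimately have "v * D < - D\<^sup>2" by linarith
    then have "v * D < (- D) * D" by (simp add: power2_eq_square)
    then have "v < - D" using 1 mult_less_cancel_right_pos by blast
    then show ?thesis using 1 unfolding v_def by linarith
  next
    case 2
    define v where "v = m * \<alpha> - \<lfloor>m * \<alpha>\<rfloor>"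
    have "v \<ge> 0" unfolding v_def by linarith
    then have "v * D \<le> 0" using 2 by (simp add: mult_nonneg_nonpos)
    moreover have "D\<^sup>2 > 0" using 2 by simp
    moreover have "v * D \<ge> D\<^sup>2 \<or> v * D < - D\<^sup>2"
      using gap[of "\<lfloor>m * \<alpha>\<rfloor>"] by (simp add: v_def)
    ultimately have "v * D < - D\<^sup>2" by linarith
    then have "v * D < (- D) * D" by (simp add: power2_eq_square)
    then have "v > - D" using 2 mult_less_cancel_right_neg by blast
    then show ?thesis using 2 unfolding v_def by linarith
  qed
  then show ?thesis by (simp add: D_def)
qed

lemma floor_add_continuant:
  fixes a :: "nat \<Rightarrow> int" and \<alpha> :: real and m :: int
  assumes "is_simple_cfrac a \<alpha>" and "k \<ge> 2"
    and "0 < m" "m < shifted_continuant a (Suc k)"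
  shows "\<lfloor>(shifted_continuant a k + m) * \<alpha>\<rfloor> = shifted_numerator a k + \<lfloor>m * \<alpha>\<rfloor>"
proof -
  have "(shifted_continuant a k + m) * \<alpha> =
      m * \<alpha> + convergent_error a \<alpha> k + shifted_numerator a k"
    by (simp add: convergent_error_def algebra_simps)
  then show ?thesis using floor_add_error[OF assms] by simp
qed

section \<open>Odd first and even later partial quotients\<close>

lemma odd_shifted_numerator:
  assumes "odd (a 0)" and "\<forall>i\<ge>1. even (a i)"
  shows "odd (shifted_numerator a (Suc k))"
proof (induction k rule: less_induct)
  case (less k)
  consider "k = 0" | "k = 1" | j where "k = Suc (Suc j)"
    by (metis One_nat_def not0_implies_Suc)
  then show ?case
  proof cases
    case (3 j)
    then show ?thesis using assms(2) less[of j] by simp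
  qed (use assms in auto)
qed

lemma sign_sum_add:
  "sign_sum (n + M) \<alpha> = sign_sum n \<alpha> + (\<Sum>m=1..M. (-1) powi \<lfloor>real (n + m) * \<alpha>\<rfloor>)"
proof (induction M)
  case (Suc M)
  then show ?case by (simp add: sign_sum_def add_ac)
qed (simp add: sign_sum_def)

lemma sign_sum_add_continuant:
  assumes cf: "is_simple_cfrac a \<alpha>" and par: "odd (a 0)" "\<forall>i\<ge>1. even (a i)"
    and k: "k \<ge> 2" and n: "int n = shifted_continuant a k"
    and M: "int M < shifted_continuant a (Suc k)"
  shows "sign_sum (n + M) \<alpha> = sign_sum n \<alpha> - sign_sum M \<alpha>"
proof -
  have oddp: "odd (shifted_numerator a k)"
    using odd_shifted_numerator[OF par, of "k - 1"] k by simp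
  have "(-1) powi \<lfloor>real (n + m) * \<alpha>\<rfloor> = - ((-1) powi \<lfloor>real m * \<alpha>\<rfloor> :: real)"
    if "m \<in> {1..M}" for m
  proof -
    have "real n = shifted_continuant a k" using n by (metis of_int_of_nat_eq)
    then have "\<lfloor>real (n + m) * \<alpha>\<rfloor> = shifted_numerator a k + \<lfloor>real m * \<alpha>\<rfloor>"
      using floor_add_continuant[OF cf k, of "int m"] that M by simp
    then show ?thesis using oddp by (simp add: power_int_add)
  qed
  then show ?thesis unfolding sign_sum_add by (simp add: sign_sum_def sum_negf)
qed

text \<open>The translated sum appears with opposite signs in consecutive blocks, so an even number of
  blocks cancels.\<close>

lemma sign_sum_even_blocks:
  assumes cf: "is_simple_cfrac a \<alpha>" and par: "odd (a 0)" "\<forall>i\<ge>1. even (a i)"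
    and k: "k \<ge> 2" and n: "int n = shifted_continuant a k"
    and "int (2 * j * n + M) \<le> shifted_continuant a (Suc k)"
  shows "sign_sum (2 * j * n + M) \<alpha> = sign_sum M \<alpha>"
  using assms(6)
proof (induction j)
  case (Suc j)
  have n0: "n > 0"
    using n shifted_continuant_pos[of a, OF _ k] cf by (simp add: is_simple_cfrac_def)
  define R where "R = 2 * j * n + M"
  have R: "2 * Suc j * n + M = n + (n + R)" by (simp add: R_def)
  have b: "int (n + R) < shifted_continuant a (Suc k)" "int R < shifted_continuant a (Suc k)"
    using Suc.prems n0 unfolding R by linarith+
  have "sign_sum (n + (n + R)) \<alpha> = sign_sum R \<alpha>"
    using sign_sum_add_continuant[OF cf par k n] b by simp
  then show ?case using Suc.IH b(2) unfolding R by (simp add: R_def)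
qed simp

text \<open>Two steps down in the recursion \<open>q\<^sub>i\<^sub>+\<^sub>1 = a\<^sub>i\<^sub>+\<^sub>1 q\<^sub>i + q\<^sub>i\<^sub>-\<^sub>1\<close> the sum is unchanged, because the even number
  of blocks of length \<open>q\<^sub>i\<close> cancels. The values at \<open>q\<^sub>-\<^sub>1 = 0\<close> and \<open>q\<^sub>0 = 1\<close> start the two parity classes.\<close>

lemma sign_sum_shifted_continuant:
  assumes cf: "is_simple_cfrac a \<alpha>" and par: "odd (a 0)" "\<forall>i\<ge>1. even (a i)"
    and "k \<ge> 1"
  shows "sign_sum (nat (shifted_continuant a k)) \<alpha> = - of_bool (even k)"
  using assms(4)
proof (induction k rule: less_induct)
  case (less k)
  have pos: "\<forall>i>0. a i > 0" using cf by (simp add: is_simple_cfrac_def)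
  consider "k = 1" | "k = 2" | j where "k = Suc (Suc (Suc j))"
    using less.prems by (metis One_nat_def Suc_1 not0_implies_Suc not_one_le_zero)
  then show ?case
  proof cases
    case 1
    then show ?thesis by (simp add: sign_sum_def)
  next
    case 2
    \<comment> \<open>The errors at indices 2 and 3 confine \<open>\<alpha>\<close> to \<open>a 0 < \<alpha> < a 0 + 1\<close>.\<close>
    have "\<alpha> > a 0"
      using convergent_error_sign[OF cf, of 2]
      by (simp add: convergent_error_def numeral_2_eq_2)
    moreover have "\<alpha> < a 0 + 1"
    proof -
      have "a 1 * (\<alpha> - a 0) < 1"
        using convergent_error_sign[OF cf, of 3]
        by (simp add: convergent_error_def numeral_3_eq_3 algebra_simps)
      moreover have "1 * (\<alpha> - a 0) \<le> a 1 * (\<alpha> - a 0)"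
        using pos \<open>\<alpha> > a 0\<close> by (intro mult_right_mono) (auto simp: int_one_le_iff_zero_less)
      ultimately have "1 * (\<alpha> - a 0) < 1" by (rule le_less_trans[rotated])
      then show ?thesis by simp
    qed
    ultimately have "\<lfloor>\<alpha>\<rfloor> = a 0" by linarith
    then show ?thesis using 2 par(1) by (simp add: sign_sum_def numeral_2_eq_2)
  next
    case (3 j)
    define n M where "n = nat (shifted_continuant a (Suc (Suc j)))"
      and "M = nat (shifted_continuant a (Suc j))"
    have nn: "shifted_continuant a i \<ge> 0" for i using shifted_continuant_nonneg[OF pos] .
    have n: "int n = shifted_continuant a (Suc (Suc j))"
      and M: "int M = shifted_continuant a (Suc j)"
      unfolding n_def M_def using nn by (auto simp del: shifted_continuant.simps)
    obtain c where c: "a (Suc j) = 2 * int c"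
    proof -
      have "even (a (Suc j))" "a (Suc j) > 0" using par(2) pos by auto
      then obtain d where "a (Suc j) = 2 * d" "d > 0" by (auto elim!: evenE)
      then show ?thesis using that[of "nat d"] by simp
    qed
    have e: "shifted_continuant a k = int (2 * c * n + M)"
      unfolding 3 shifted_continuant.simps(3)[of a "Suc j"] c n[symmetric] M[symmetric] by simp
    have "sign_sum (2 * c * n + M) \<alpha> = sign_sum M \<alpha>"
      using sign_sum_even_blocks[OF cf par _ n] e 3 by (simp del: shifted_continuant.simps)
    then have "sign_sum (nat (shifted_continuant a k)) \<alpha> = sign_sum M \<alpha>" unfolding e nat_int .
    also have "\<dots> = - of_bool (even (Suc j))"
      unfolding M_def using less.IH[of "Suc j"] 3 by simp
    finally show ?thesis using 3 by simp
  qed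
qed

lemma sign_sum_continuant:
  assumes "is_simple_cfrac a \<alpha>" "odd (a 0)" "\<forall>i\<ge>1. even (a i)"
  shows "sign_sum (nat (continuant a i)) \<alpha> = - of_bool (even i)"
  using sign_sum_shifted_continuant[OF assms, of "i + 2"]
  by (simp add: continuant_def del: shifted_continuant.simps)

section \<open>The greedy expansion\<close>

definition digit_sum :: "(nat \<Rightarrow> nat) \<Rightarrow> nat \<Rightarrow> real" where
  "digit_sum Z I = (\<Sum>i=0..I. (\<Prod>t=i+1..I. (-1) ^ Z t) * of_bool (even i) * of_bool (odd (Z i)))"

lemma digit_sum_Suc:
  "digit_sum Z (Suc I) =
     (-1) ^ Z (Suc I) * digit_sum Z I + of_bool (even (Suc I)) * of_bool (odd (Z (Suc I)))"
proof -
  have "(\<Sum>i=0..I. (\<Prod>t=i+1..Suc I. (-1) ^ Z t) * of_bool (even i) * of_bool (odd (Z i)))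
      = (-1) ^ Z (Suc I) * digit_sum Z I"
    unfolding digit_sum_def sum_distrib_left by (rule sum.cong) auto
  then show ?thesis unfolding digit_sum_def by simp
qed

lemma digit_sum_cong:
  assumes "\<And>i. i \<le> I \<Longrightarrow> Z i = Z' i"
  shows "digit_sum Z I = digit_sum Z' I"
  using assms by (induction I) (simp_all add: digit_sum_Suc, simp add: digit_sum_def)

lemma digit_sum_extend:
  assumes "\<forall>i>I. Z i = 0" and "I \<le> J"
  shows "digit_sum Z J = digit_sum Z I"
  using assms(2)
proof (induction J rule: dec_induct)
  case (step J)
  then show ?case using assms(1) by (simp add: digit_sum_Suc)
qed simp

lemma digit_sum_increment:
  "digit_sum (Z(i := Z i + 1)) i = of_bool (even i) - digit_sum Z i"
proof (cases i)
  case 0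
  then show ?thesis by (simp add: digit_sum_def of_bool_def)
next
  case (Suc j)
  have "digit_sum (Z(i := Z i + 1)) j = digit_sum Z j"
    by (rule digit_sum_cong) (simp add: Suc)
  then show ?thesis unfolding Suc digit_sum_Suc by simp
qed

lemma is_cfe_digit_bound:
  assumes pos: "\<forall>i>0. a i > 0" and "is_cfe a N Z" and "Z k \<noteq> 0"
  shows "continuant a k \<le> int N"
  using assms(2,3)
proof (induction rule: is_cfe.induct)
  case (step i N M Z)
  show ?case
  proof (cases "k = i")
    case False
    then have "continuant a k \<le> int M" using step by simp
    then show ?thesis using step.hyps continuant_pos[OF pos, of i] by linarith
  qed (use step in simp)
qed simp

theorem theorem4p4:
  fixes a :: "nat \<Rightarrow> int" and \<alpha> :: real and N I :: nat and Z :: "nat \<Rightarrow> nat"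
  assumes "is_simple_cfrac a \<alpha>"
    and "odd (a 0)"
    and "\<forall>i\<ge>1. even (a i)"
    and "N \<ge> 1"
    and "is_cfe a N Z"
    and "\<forall>i>I. Z i = 0"
  shows "sign_sum N \<alpha> =
    - (\<Sum>i=0..I. (\<Prod>t=i+1..I. (-1) ^ Z t) * of_bool (even i) * of_bool (odd (Z i)))"
proof -
  have pos: "\<forall>i>0. a i > 0" using assms(1) by (simp add: is_simple_cfrac_def)
  have "sign_sum N \<alpha> = - digit_sum Z I" using assms(5,6)
  proof (induction arbitrary: I rule: is_cfe.induct)
    case zero
    show ?case by (simp add: sign_sum_def digit_sum_def)
  next
    case (step i N M Z)
    \<comment> \<open>The greedy choice of \<open>i\<close> leaves no digit of the remainder above \<open>i\<close>.\<close>
    have Z: "\<forall>k>i. Z k = 0"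
    proof (intro allI impI)
      fix k assume "k > i"
      then have "int N < continuant a k" using step.hyps(2) by blast
      then have "\<not> continuant a k \<le> int M"
        using step.hyps(4) continuant_pos[OF pos, of i] by linarith
      then show "Z k = 0" using is_cfe_digit_bound[OF pos step.hyps(3)] by blast
    qed
    have "i \<le> I"
    proof (rule ccontr)
      assume "\<not> i \<le> I"
      then have "(Z(i := Z i + 1)) i = 0" using step.prems by (meson not_le)
      then show False by simp
    qed
    define n where "n = nat (continuant a i)"
    have n: "int n = shifted_continuant a (i + 2)"
      using continuant_pos[OF pos, of i] by (simp add: n_def continuant_def)
    have N: "N = n + M" using n step.hyps(4) by (simp add: continuant_def)
    have "int N < continuant a (Suc i)" using step.hyps(2) by simp
    then have M: "int M < shifted_continuant a (Suc (i + 2))"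
      unfolding N continuant_def by (simp del: shifted_continuant.simps)
    have "sign_sum N \<alpha> = - of_bool (even i) - sign_sum M \<alpha>"
      unfolding N using sign_sum_add_continuant[OF assms(1-3) _ n M]
        sign_sum_continuant[OF assms(1-3), of i] by (simp add: n_def)
    also have "\<dots> = - digit_sum (Z(i := Z i + 1)) i"
      using step.IH[OF Z] by (simp only: digit_sum_increment)
    also have "\<dots> = - digit_sum (Z(i := Z i + 1)) I"
      using digit_sum_extend[of i "Z(i := Z i + 1)" I] Z \<open>i \<le> I\<close> by simp
    finally show ?case .
  qed
  then show ?thesis by (simp add: digit_sum_def)
qed

end
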